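(* Let $G$ be a graph and let $v$ be a vertex of $G$. Then: (1) $|\alpha'_g(G)-\hat\alpha'_g(G)|\le 1$; and (2) $\alpha'_g(G)\ge \alpha'_g(G-v)$ and $\hat\alpha'_g(G)\ge\hat\alpha'_g(G-v)$.
   Context: Graphs are finite and simple. The matching game on a graph $G$: two players, Max and Min, alternately add edges of $G$ to a set of chosen edges that must always remain a matching; the game ends when the chosen edges form a maximal matching of $G$ (no further edge can be added). Max wants the final matching to be large, Min wants it to be small. $\alpha'_g(G)$ denotes the size of the final matching under optimal play when Max moves first, and $\hat\alpha'_g(G)$ denotes the size of the final matching under optimal play when Min moves first. $G-v$ denotes the graph obtained from $G$ by deleting the vertex $v$ and all incident edges. *)

theory Defs
  imports Main
begin

record 'a sgraph =
  verts :: "'a set"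
  edges :: "'a set set"

locale finite_simple_graph =
  fixes G :: "'a sgraph"
  assumes finite_verts: "finite (verts G)"
    and edges_wf: "\<And>e. e \<in> edges G \<Longrightarrow> e \<subseteq> verts G \<and> card e = 2"

definition delete_vertex :: "'a sgraph \<Rightarrow> 'a \<Rightarrow> 'a sgraph" where
  "delete_vertex G v = \<lparr>verts = verts G - {v}, edges = {e \<in> edges G. v \<notin> e}\<rparr>"

definition matching :: "'a sgraph \<Rightarrow> 'a set set \<Rightarrow> bool" where
  "matching G M \<longleftrightarrow> M \<subseteq> edges G \<and> pairwise disjnt M"

definition maximal_matching :: "'a sgraph \<Rightarrow> 'a set set \<Rightarrow> bool" where
  "maximal_matching G M \<longleftrightarrow>
     matching G M \<and> (\<forall>M'. matching G M' \<and> M \<subseteq> M' \<longrightarrow> M' = M)"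

definition moves :: "'a sgraph \<Rightarrow> 'a set set \<Rightarrow> 'a set set" where
  "moves G M = {e \<in> edges G - M. matching G (insert e M)}"

lemma maximal_matching_iff_no_moves:
  assumes "matching G M"
  shows "maximal_matching G M \<longleftrightarrow> moves G M = {}"
proof
  assume max: "maximal_matching G M"
  show "moves G M = {}"
  proof (rule ccontr)
    assume "moves G M \<noteq> {}"
    then obtain e where "e \<notin> M" "matching G (insert e M)"
      by (auto simp: moves_def)
    with max show False
      unfolding maximal_matching_def by blast
  qed
next
  assume none: "moves G M = {}"
  have "M' = M" if M': "matching G M'" "M \<subseteq> M'" for M'
  proof (rule ccontr)
    assume "M' \<noteq> M"
    then obtain e where e: "e \<in> M'" "e \<notin> M" using M' by blast
    have "matching G (insert e M)"
      using M' e unfolding matching_def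
      by (meson insert_subset order.trans pairwise_subset)
    then have "e \<in> moves G M"
      using e by (auto simp: moves_def matching_def)
    with none show False by simp
  qed
  with assms show "maximal_matching G M"
    unfolding maximal_matching_def by blast
qed

datatype player = Maximizer | Minimizer

fun opponent :: "player \<Rightarrow> player" where
  "opponent Maximizer = Minimizer"
| "opponent Minimizer = Maximizer"

fun best :: "player \<Rightarrow> nat set \<Rightarrow> nat" where
  "best Maximizer S = Max S"
| "best Minimizer S = Min S"

text \<open>
  \<^term>\<open>game_value G p M\<close> is the size of the final matching under optimal play from the
  position where the edges in \<^term>\<open>M\<close> have been chosen and player \<^term>\<open>p\<close> is to move.
  It is the minimax value of the finite game tree. By \<open>maximal_matching_iff_no_moves\<close> the game
  ends exactly at the maximal matchings. The test \<^term>\<open>infinite (edges G)\<close> only makes the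
  function total; it is false for every finite simple graph.
\<close>

function game_value :: "'a sgraph \<Rightarrow> player \<Rightarrow> 'a set set \<Rightarrow> nat" where
  "game_value G p M =
     (if infinite (edges G) \<or> moves G M = {} then card M
      else best p ((\<lambda>e. game_value G (opponent p) (insert e M)) ` moves G M))"
  by pat_completeness auto
termination
proof (relation "Wellfounded.measure (\<lambda>(G, p, M). card (edges G - M))")
  fix G :: "'a sgraph" and p :: player and M e
  assume nonend: "\<not> (infinite (edges G) \<or> moves G M = {})" and e: "e \<in> moves G M"
  from e have "edges G - insert e M \<subset> edges G - M"
    by (auto simp: moves_def)
  with nonend show "((G, opponent p, insert e M), (G, p, M)) \<in>
      Wellfounded.measure (\<lambda>(G, p, M). card (edges G - M))"
    by (simp add: psubset_card_mono)
qed simp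

declare game_value.simps [simp del]

text \<open>The suffix names the player who moves first.\<close>

definition game_matching_number_Max :: "'a sgraph \<Rightarrow> nat" where
  "game_matching_number_Max G = game_value G Maximizer {}"

definition game_matching_number_Min :: "'a sgraph \<Rightarrow> nat" where
  "game_matching_number_Min G = game_value G Minimizer {}"

end

(* The future of the matching game depends only on the set of edges that can still be chosen.
   Monotonicity under vertex deletion is proved by induction on the number of such edges. The
   only critical case is Min playing an edge vu of G through the deleted vertex v. With
   H = G - v it requires that the Min-start value of H be at most one more than the Max-start
   value of H - u. If u is isolated in H, this follows from the smaller instances by letting Min
   play any edge; otherwise Min plays an edge uw, and monotonicity applies to H - u and w. Once
   monotonicity holds, a first move costs one edge and passes to a subgraph, so the two
   starting values differ by at most one. *)

theory Submission
  imports Defs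
begin

definition edges_avoiding :: "'a \<Rightarrow> 'a set set \<Rightarrow> 'a set set" where
  "edges_avoiding v F = {f \<in> F. v \<notin> f}"

text \<open>\<open>{}\<close> is disjoint from itself, so \<open>e\<close> is removed explicitly:
  every move then shrinks \<open>F\<close>, even for arbitrary sets, and
  \<open>remaining_moves\<close> terminates.\<close>

definition edges_after :: "'a set set \<Rightarrow> 'a set \<Rightarrow> 'a set set" where
  "edges_after F e = {f \<in> F - {e}. disjnt f e}"

text \<open>Number of edges still to be played under optimal play when \<open>F\<close> holds the
  available ones. The value 0 at infinite \<open>F\<close> is only a default.\<close>

function remaining_moves :: "player \<Rightarrow> 'a set set \<Rightarrow> nat" where
  "remaining_moves p F =
     (if infinite F \<or> F = {} then 0
      else best p ((\<lambda>e. Suc (remaining_moves (opponent p) (edges_after F e))) ` F))"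
  by pat_completeness auto
termination
  by (relation "Wellfounded.measure (\<lambda>(p, F). card F)")
     (auto simp: edges_after_def intro!: psubset_card_mono)

declare remaining_moves.simps [simp del]

lemma remaining_moves_empty [simp]: "remaining_moves p {} = 0"
  by (simp add: remaining_moves.simps)

lemma remaining_moves_Maximizer_ge:
  assumes "finite F" "e \<in> F"
  shows "Suc (remaining_moves Minimizer (edges_after F e)) \<le> remaining_moves Maximizer F"
  using assms by (subst (2) remaining_moves.simps) (auto intro!: Max_ge)

lemma remaining_moves_Minimizer_le:
  assumes "finite F" "e \<in> F"
  shows "remaining_moves Minimizer F \<le> Suc (remaining_moves Maximizer (edges_after F e))"
  using assms by (subst remaining_moves.simps) (auto intro!: Min_le)

lemma best_in:
  assumes "finite S" "S \<noteq> {}"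
  shows "best p S \<in> S"
  using assms by (cases p) simp_all

lemma remaining_moves_attained:
  assumes "finite F" "F \<noteq> {}"
  obtains e where "e \<in> F"
    "remaining_moves p F = Suc (remaining_moves (opponent p) (edges_after F e))"
proof -
  have "remaining_moves p F
      \<in> (\<lambda>e. Suc (remaining_moves (opponent p) (edges_after F e))) ` F"
    using assms by (subst remaining_moves.simps) (simp add: best_in)
  then show ?thesis using that by blast
qed

text \<open>Playing an edge amounts to deleting its two ends, so monotonicity under vertex deletion
  also compares positions before and after a move.\<close>

lemma edges_after_pair:
  "edges_after F {u, w} = edges_avoiding w (edges_avoiding u F)"
  by (auto simp: edges_after_def edges_avoiding_def disjnt_def)

lemma edges_after_avoiding:
  "edges_after (edges_avoiding v F) e = edges_avoiding v (edges_after F e)"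
  by (auto simp: edges_after_def edges_avoiding_def)

lemma edges_avoiding_subset: "edges_avoiding v F \<subseteq> F"
  by (auto simp: edges_avoiding_def)

lemma edges_after_psubset: "e \<in> F \<Longrightarrow> edges_after F e \<subset> F"
  by (auto simp: edges_after_def)

text \<open>Monotonicity is a hypothesis here because the bound is used inside the induction that
  proves it, where it is known only for smaller edge sets.\<close>

lemma remaining_moves_Minimizer_le_avoiding:
  assumes fin: "finite H" and two: "\<And>e. e \<in> H \<Longrightarrow> card e = 2"
    and mono: "\<And>K v p. K \<subseteq> H \<Longrightarrow>
      remaining_moves p (edges_avoiding v K) \<le> remaining_moves p K"
  shows "remaining_moves Minimizer H \<le> Suc (remaining_moves Maximizer (edges_avoiding u H))"
proof (cases "edges_avoiding u H = H")
  case True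
  show ?thesis
  proof (cases "H = {}")
    case False
    then obtain e where e: "e \<in> H" by blast
    then obtain x y where xy: "e = {x, y}" using two by (meson card_2_iff)
    have "remaining_moves Minimizer H \<le> Suc (remaining_moves Maximizer (edges_after H e))"
      using fin e by (rule remaining_moves_Minimizer_le)
    also have "\<dots> \<le> Suc (remaining_moves Maximizer H)"
      unfolding xy edges_after_pair
      using mono[OF edges_avoiding_subset] mono[OF order_refl] by (meson Suc_le_mono order_trans)
    finally show ?thesis using True by simp
  qed simp
next
  case False
  then obtain e where e: "e \<in> H" "u \<in> e" by (auto simp: edges_avoiding_def)
  then obtain w where uw: "e = {u, w}"
    using two by (metis card_2_iff insert_commute insertE singletonD)
  have "remaining_moves Minimizer H \<le> Suc (remaining_moves Maximizer (edges_after H e))"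
    using fin e(1) by (rule remaining_moves_Minimizer_le)
  \<comment> \<open>The move already deletes \<open>u\<close>; monotonicity pays only for the other
    end \<open>w\<close>.\<close>
  also have "\<dots> \<le> Suc (remaining_moves Maximizer (edges_avoiding u H))"
    unfolding uw edges_after_pair using mono[OF edges_avoiding_subset] by simp
  finally show ?thesis .
qed

text \<open>Max copies an optimal first edge of the smaller graph in the larger one. Min copies an
  optimal first edge of the larger graph in the smaller one, which fails only if that edge contains
  \<open>v\<close>.\<close>

lemma remaining_moves_avoiding_le:
  assumes "finite F" "\<And>e. e \<in> F \<Longrightarrow> card e = 2"
  shows "remaining_moves p (edges_avoiding v F) \<le> remaining_moves p F"
  using assms
proof (induction F arbitrary: v p rule: finite_psubset_induct)
  case (psubset F)
  let ?H = "edges_avoiding v F"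
  have IH: "remaining_moves q (edges_avoiding x K) \<le> remaining_moves q K"
    if "K \<subset> F" for K x q
    using that psubset.prems by (intro psubset.IH) auto
  have finH: "finite ?H"
    using psubset.hyps edges_avoiding_subset by (rule finite_subset[rotated])
  show ?case
  proof (cases "?H = F \<or> ?H = {}")
    case True
    then show ?thesis by auto
  next
    case False
    \<comment> \<open>Strictness puts every subset of \<open>?H\<close>, including \<open>?H\<close>
      itself, within reach of the induction hypothesis.\<close>
    then have HF: "?H \<subset> F" and nonempty: "?H \<noteq> {}"
      using edges_avoiding_subset[of v F] by blast+
    show ?thesis
    proof (cases p)
      case Maximizer
      obtain e where e: "e \<in> ?H"
        "remaining_moves Maximizer ?H = Suc (remaining_moves Minimizer (edges_after ?H e))"
        using remaining_moves_attained[OF finH nonempty, of Maximizer] by auto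
      then have eF: "e \<in> F" using HF by blast
      have "remaining_moves Maximizer ?H \<le> Suc (remaining_moves Minimizer (edges_after F e))"
        using e(2) IH[OF edges_after_psubset[OF eF]] by (simp add: edges_after_avoiding)
      also have "\<dots> \<le> remaining_moves Maximizer F"
        using psubset.hyps eF by (rule remaining_moves_Maximizer_ge)
      finally show ?thesis using Maximizer by simp
    next
      case Minimizer
      obtain e where e: "e \<in> F"
        "remaining_moves Minimizer F = Suc (remaining_moves Maximizer (edges_after F e))"
        using remaining_moves_attained[OF psubset.hyps, of Minimizer] HF by auto
      have "remaining_moves Minimizer ?H \<le> Suc (remaining_moves Maximizer (edges_after F e))"
      proof (cases "v \<in> e")
        case True
        then obtain u where vu: "e = {v, u}"
          using psubset.prems[OF e(1)] by (metis card_2_iff insert_commute insertE singletonD)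
        \<comment> \<open>Playing \<open>{v, u}\<close> in \<open>F\<close> leaves exactly the edges
          of \<open>?H\<close> that avoid \<open>u\<close>, so this bound replaces the move that Min
          cannot copy.\<close>
        have "remaining_moves Minimizer ?H
            \<le> Suc (remaining_moves Maximizer (edges_avoiding u ?H))"
          using finH HF psubset.prems IH
          by (intro remaining_moves_Minimizer_le_avoiding) auto
        then show ?thesis by (simp add: vu edges_after_pair)
      next
        case False
        then have "e \<in> ?H" using e(1) by (simp add: edges_avoiding_def)
        with finH have "remaining_moves Minimizer ?H
            \<le> Suc (remaining_moves Maximizer (edges_after ?H e))"
          by (rule remaining_moves_Minimizer_le)
        also have "\<dots> \<le> Suc (remaining_moves Maximizer (edges_after F e))"
          using IH[OF edges_after_psubset[OF e(1)]] by (simp add: edges_after_avoiding)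
        finally show ?thesis .
      qed
      then show ?thesis using e(2) Minimizer by simp
    qed
  qed
qed

lemma remaining_moves_players_close:
  assumes fin: "finite F" and two: "\<And>e. e \<in> F \<Longrightarrow> card e = 2"
  shows "remaining_moves Minimizer F \<le> Suc (remaining_moves Maximizer F)"
    and "remaining_moves Maximizer F \<le> Suc (remaining_moves Minimizer F)"
proof -
  have mono: "remaining_moves q (edges_avoiding x K) \<le> remaining_moves q K"
    if "K \<subseteq> F" for K x q
    using that fin two by (intro remaining_moves_avoiding_le) (auto intro: finite_subset)
  have after: "remaining_moves q (edges_after F e) \<le> remaining_moves q F"
    if e: "e \<in> F" for e q
  proof -
    obtain x y where "e = {x, y}" using two[OF e] by (meson card_2_iff)
    then show ?thesis
      using mono[OF edges_avoiding_subset] mono[OF order_refl]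
      by (metis edges_after_pair order_trans)
  qed
  show "remaining_moves Minimizer F \<le> Suc (remaining_moves Maximizer F)"
    \<comment> \<open>The deleted vertex is arbitrary: it is removed by the first bound and restored
      by monotonicity.\<close>
    using remaining_moves_Minimizer_le_avoiding[OF fin two mono] mono[OF order_refl]
    by (meson Suc_le_mono order_trans)
  show "remaining_moves Maximizer F \<le> Suc (remaining_moves Minimizer F)"
  proof (cases "F = {}")
    case False
    from remaining_moves_attained[OF fin this, of Maximizer] obtain e where "e \<in> F"
      "remaining_moves Maximizer F = Suc (remaining_moves Minimizer (edges_after F e))"
      by auto
    then show ?thesis using after by simp
  qed simp
qed

lemma best_add_image:
  assumes "finite A" "A \<noteq> {}"
  shows "best p ((\<lambda>x. c + f x) ` A) = c + best p (f ` A)"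
proof -
  have "mono ((+) c)" by (simp add: monoI)
  then have "best p ((+) c ` f ` A) = c + best p (f ` A)"
    using assms by (cases p) (simp_all add: mono_Max_commute mono_Min_commute)
  then show ?thesis by (simp add: image_image)
qed

text \<open>A nonempty edge is not disjoint from itself, so disjointness from all of
  \<open>M\<close> already rules out membership in \<open>M\<close>.\<close>

lemma moves_eq:
  assumes "matching G M" "{} \<notin> edges G"
  shows "moves G M = {e \<in> edges G. \<forall>m\<in>M. disjnt e m}"
proof -
  have "e \<notin> M" if "e \<in> edges G" "\<forall>m\<in>M. disjnt e m" for e
    using that assms(2) by (auto simp: disjnt_def)
  then show ?thesis
    using assms(1)
    by (auto simp: moves_def matching_def pairwise_insert disjnt_sym)
qed

lemma moves_insert:
  assumes "matching G M" "{} \<notin> edges G" "e \<in> moves G M"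
  shows "moves G (insert e M) = edges_after (moves G M) e"
proof -
  have "matching G (insert e M)" "e \<noteq> {}"
    using assms(2,3) by (auto simp: moves_def)
  then show ?thesis
    using assms(1,2) by (auto simp: moves_eq edges_after_def)
qed

text \<open>Induction along the game tree: each move raises \<open>card M\<close> by one, matching
  the \<open>Suc\<close> in \<open>remaining_moves\<close>, and turns the available edges into
  \<open>edges_after\<close>.\<close>

lemma game_value_eq:
  assumes "finite (edges G)" "{} \<notin> edges G" "matching G M"
  shows "game_value G p M = card M + remaining_moves p (moves G M)"
  using assms
proof (induction G p M rule: game_value.induct)
  case (1 G p M)
  have finM: "finite M"
    using 1 by (auto simp: matching_def intro: finite_subset)
  have finmoves: "finite (moves G M)"
    using 1 by (simp add: moves_def)
  show ?case
  proof (cases "moves G M = {}")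
    case True
    then show ?thesis by (simp add: game_value.simps)
  next
    case False
    have step: "game_value G (opponent p) (insert e M) =
        card M + Suc (remaining_moves (opponent p) (edges_after (moves G M) e))"
      if e: "e \<in> moves G M" for e
    proof -
      have "matching G (insert e M)" "e \<notin> M" using e by (auto simp: moves_def)
      then show ?thesis
        using 1 False e finM by (simp add: moves_insert)
    qed
    have "game_value G p M =
        best p ((\<lambda>e. game_value G (opponent p) (insert e M)) ` moves G M)"
      using 1 False by (simp add: game_value.simps[of G p M])
    also have "\<dots> = best p ((\<lambda>e. card M +
        Suc (remaining_moves (opponent p) (edges_after (moves G M) e))) ` moves G M)"
      using step by (simp cong: image_cong)
    also have "\<dots> = card M + remaining_moves p (moves G M)"
      by (subst best_add_image[OF finmoves False], subst (2) remaining_moves.simps)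
         (use finmoves False in simp)
    finally show ?thesis .
  qed
qed

lemma game_value_start:
  assumes "finite (edges G)" "{} \<notin> edges G"
  shows "game_value G p {} = remaining_moves p (edges G)"
proof -
  have "matching G {}" by (simp add: matching_def)
  with assms show ?thesis by (simp add: game_value_eq moves_eq)
qed

theorem theorem2p3:
  fixes G :: "'a sgraph" and v :: 'a
  assumes "finite_simple_graph G" and "v \<in> verts G"
  shows "\<bar>int (game_matching_number_Max G) - int (game_matching_number_Min G)\<bar> \<le> 1
    \<and> game_matching_number_Max G \<ge> game_matching_number_Max (delete_vertex G v)
    \<and> game_matching_number_Min G \<ge> game_matching_number_Min (delete_vertex G v)"
proof -
  interpret finite_simple_graph G by fact
  have fin: "finite (edges G)"
    using finite_verts edges_wf by (intro finite_subset[of "edges G" "Pow (verts G)"]) auto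
  have two: "\<And>e. e \<in> edges G \<Longrightarrow> card e = 2"
    using edges_wf by blast
  have nonempty: "{} \<notin> edges G"
    using two by fastforce
  have del: "edges (delete_vertex G v) = edges_avoiding v (edges G)"
    by (simp add: delete_vertex_def edges_avoiding_def)
  have "game_value G p {} = remaining_moves p (edges G)"
    and "game_value (delete_vertex G v) p {} = remaining_moves p (edges_avoiding v (edges G))"
    for p
    using fin nonempty by (simp_all add: game_value_start del edges_avoiding_def)
  then show ?thesis
    using remaining_moves_players_close[OF fin two]
      remaining_moves_avoiding_le[OF fin two, of _ v]
    unfolding game_matching_number_Max_def game_matching_number_Min_def by auto
qed

end
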